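(* Let $g$, $(p_k)$, $(b_n)$ and the operators $L_n^{\ast}$ be as defined in the context. Let $f\in C_E[0,\infty)$, i.e. $f:[0,\infty)\to\mathbb{R}$ is continuous and there are finite constants $\alpha,\beta>0$ with $|f(x)|\le \beta e^{\alpha x}$ for all $x\ge 0$. Then for every $a>0$, $$\lim_{n\to\infty} L_n^{\ast}(f;x)=f(x)\quad\text{uniformly for } x\in[0,a].$$
   Context: Let $g(u)=\sum_{n=0}^{\infty}a_n u^n$ (real coefficients $a_n$) be analytic in a disk $|u|<r$ with $r>1$, and assume $g(1)\neq 0$. The Appell polynomials are $p_k(x)=\sum_{i=0}^{k}a_i\frac{x^{k-i}}{(k-i)!}$, $k=0,1,2,\dots$; equivalently $g(u)e^{ux}=\sum_{k=0}^{\infty}p_k(x)u^k$. Let $(b_n)_{n\ge 1}$ be an increasing sequence of positive reals with $\lim_{n\to\infty} b_n=\infty$ and $\lim_{n\to\infty} b_n/n=0$. The Kantorovich type Jakimovski-Leviatan operators are, for $x\ge 0$, $$L_n^{\ast}(f;x)=\frac{e^{-\frac{n}{b_n}x}}{g(1)}\,\frac{n}{b_n}\sum_{k=0}^{\infty}p_k\!\left(\frac{n}{b_n}x\right)\int_{\frac{k}{n}b_n}^{\frac{k+1}{n}b_n}f(t)\,dt .$$ For $f\in C_E[0,\infty)$ with $|f(x)|\le\beta e^{\alpha x}$ the series is considered for all $n$ large enough that it converges (e.g. $e^{\alpha b_n/n}<r$); the limit concerns such $n$. *)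

theory Defs
  imports "HOL-Analysis.Analysis"
begin

definition appell :: "(nat \<Rightarrow> real) \<Rightarrow> nat \<Rightarrow> real \<Rightarrow> real" where
  "appell c k x = (\<Sum>i\<le>k. c i * (x ^ (k - i) / fact (k - i)))"

definition C_E :: "(real \<Rightarrow> real) set" where
  "C_E = {f. continuous_on {0..} f \<and>
             (\<exists>\<alpha> \<beta>. \<alpha> > 0 \<and> \<beta> > 0 \<and> (\<forall>x\<ge>0. \<bar>f x\<bar> \<le> \<beta> * exp (\<alpha> * x)))}"

definition kantorovich_term ::
  "(nat \<Rightarrow> real) \<Rightarrow> (nat \<Rightarrow> real) \<Rightarrow> nat \<Rightarrow> (real \<Rightarrow> real) \<Rightarrow> real \<Rightarrow> nat \<Rightarrow> real" where
  "kantorovich_term c b n f x k =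
     appell c k (real n / b n * x) *
     integral {real k / real n * b n .. (real k + 1) / real n * b n} f"

text \<open>The function \<open>g\<close> is complex-valued, but its Taylor coefficients \<open>c\<close> will be real, so
  \<open>g 1\<close> is real and \<open>Re (g 1)\<close> is just \<open>g 1\<close> read as a real number. The series is
  meaningful only for those \<open>n\<close> for which \<open>kantorovich_term c b n f x\<close> is summable.\<close>

definition kantorovich_JL ::
  "(complex \<Rightarrow> complex) \<Rightarrow> (nat \<Rightarrow> real) \<Rightarrow> (nat \<Rightarrow> real) \<Rightarrow> nat \<Rightarrow> (real \<Rightarrow> real) \<Rightarrow> real \<Rightarrow> real" where
  "kantorovich_JL g c b n f x =
     exp (- (real n / b n * x)) / Re (g 1) * (real n / b n) *
     (\<Sum>k. kantorovich_term c b n f x k)"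

end

theory Submission
  imports Defs
begin

text \<open>Since the \<open>c i\<close> may have either sign, the operators need not be positive; but
  \<open>\<bar>appell c k y\<bar>\<close> is dominated for \<open>y \<ge> 0\<close> by the Appell polynomial with coefficients \<open>\<bar>c i\<bar>\<close>.
  Instead of the quadratic test function of Korovkin's theorem, \<open>cosh (l * (t - x)) - 1\<close> is used:
  it controls \<open>\<bar>f t - f x\<bar>\<close> both near \<open>x\<close> (up to \<open>e\<close>) and at infinity, and its image under the
  dominating operator is read off from the generating function at \<open>u = exp (\<plusminus> l * h)\<close>
  with \<open>h = b n / n\<close>. This image tends to \<open>0\<close> as \<open>h \<rightarrow> 0\<close> because
  \<open>(exp (\<plusminus> l * h) - 1) / h \<rightarrow> \<plusminus> l\<close>.\<close>

section \<open>Generating function and domination of Appell polynomials\<close>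

text \<open>Cauchy product of the series of \<open>c i * u ^ i\<close> with the exponential series
  of \<open>y * u\<close>. It serves both for \<open>c\<close> and for the dominating coefficients
  \<open>\<bar>c i\<bar>\<close>.\<close>

lemma appell_generating_function:
  fixes c :: "nat \<Rightarrow> real"
  assumes "summable (\<lambda>i. \<bar>c i\<bar> * u ^ i)" and "u > 0"
  shows "(\<lambda>k. appell c k y * u ^ k) sums ((\<Sum>i. c i * u ^ i) * exp (y * u))"
proof -
  have "summable (\<lambda>i. norm (c i * u ^ i))"
    using assms by (simp add: abs_mult)
  moreover have "summable (\<lambda>i. norm ((y * u) ^ i /\<^sub>R fact i))"
    by (rule summable_norm_exp)
  ultimately have "(\<lambda>k. \<Sum>i\<le>k. (c i * u ^ i) * ((y * u) ^ (k - i) /\<^sub>R fact (k - i)))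
      sums ((\<Sum>i. c i * u ^ i) * (\<Sum>i. (y * u) ^ i /\<^sub>R fact i))"
    by (rule Cauchy_product_sums)
  moreover have "(\<Sum>i\<le>k. (c i * u ^ i) * ((y * u) ^ (k - i) /\<^sub>R fact (k - i))) = appell c k y * u ^ k" for k
    unfolding appell_def sum_distrib_right
  proof (rule sum.cong[OF refl])
    fix i assume "i \<in> {..k}"
    then have "u ^ k = u ^ i * u ^ (k - i)"
      by (simp flip: power_add)
    then show "(c i * u ^ i) * ((y * u) ^ (k - i) /\<^sub>R fact (k - i)) =
        c i * (y ^ (k - i) / fact (k - i)) * u ^ k"
      by (simp add: power_mult_distrib divide_inverse)
  qed
  ultimately show ?thesis
    by (simp add: exp_def)
qed

lemma abs_appell_le:
  assumes "y \<ge> 0"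
  shows "\<bar>appell c k y\<bar> \<le> appell (\<lambda>i. \<bar>c i\<bar>) k y"
  unfolding appell_def
  by (rule order_trans[OF sum_abs]) (use assms in \<open>auto simp: abs_mult intro!: sum_mono\<close>)

section \<open>Estimates on a single cell and convergence of the series\<close>

text \<open>Of the two exponentials in \<open>cosh\<close>, one increases and one decreases in
  \<open>t\<close>, so each is bounded at its own endpoint.\<close>

lemma cosh_le_endpoints:
  fixes l x t p q :: real
  assumes "l \<ge> 0" "p \<le> t" "t \<le> q"
  shows "cosh (l * (t - x)) \<le> (exp (l * (q - x)) + exp (- (l * (p - x)))) / 2"
proof -
  have "exp (l * (t - x)) \<le> exp (l * (q - x))" "exp (- (l * (t - x))) \<le> exp (- (l * (p - x)))"
    using assms by (auto intro!: mult_left_mono)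
  then have "exp (l * (t - x)) + exp (- (l * (t - x))) \<le> exp (l * (q - x)) + exp (- (l * (p - x)))"
    by (rule add_mono)
  then show ?thesis
    unfolding cosh_field_def by (rule divide_right_mono) simp
qed

text \<open>The mean of \<open>f - v\<close> over a cell inherits the pointwise bound. Endpoint
  exponentials replace \<open>cosh\<close> because they are geometric in \<open>k\<close>, hence
  summable against Appell polynomials in closed form.\<close>

lemma cell_mean_bound:
  fixes f :: "real \<Rightarrow> real"
  assumes f: "continuous_on {0..} f" and "h > 0" and "C \<ge> 0" and "l \<ge> 0"
    and bd: "\<And>t. t \<ge> 0 \<Longrightarrow> \<bar>f t - v\<bar> \<le> e + C * (cosh (l * (t - x)) - 1)"
  shows "\<bar>integral {real k * h..(real k + 1) * h} f / h - v\<bar> \<le>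
    e + C * ((exp (l * h) * exp (- (l * x)) * exp (l * h) ^ k + exp (l * x) * exp (- (l * h)) ^ k) / 2 - 1)"
    (is "_ \<le> ?B")
proof -
  let ?p = "real k * h" and ?q = "(real k + 1) * h"
  have pq: "0 \<le> ?p" "?p \<le> ?q" "?q - ?p = h"
    using \<open>h > 0\<close> by (auto simp: algebra_simps)
  have cont: "continuous_on {?p..?q} f"
    by (rule continuous_on_subset[OF f]) (use pq in auto)
  have "norm (integral {?p..?q} (\<lambda>t. f t - v)) \<le> ?B * (?q - ?p)"
  proof (rule integral_bound)
    show "continuous_on {?p..?q} (\<lambda>t. f t - v)"
      by (intro continuous_intros cont)
    fix t assume t: "t \<in> {?p..?q}"
    \<comment> \<open>The right endpoint \<open>(k + 1) * h\<close> causes the extra factor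
      \<open>exp (l * h)\<close>, which tends to 1 as \<open>h\<close> tends to 0.\<close>
    have "exp (l * (?q - x)) = exp (l * h) * exp (- (l * x)) * exp (l * h) ^ k"
      "exp (- (l * (?p - x))) = exp (l * x) * exp (- (l * h)) ^ k"
      by (simp_all flip: exp_add exp_of_nat_mult add: algebra_simps)
    then have "cosh (l * (t - x)) \<le>
        (exp (l * h) * exp (- (l * x)) * exp (l * h) ^ k + exp (l * x) * exp (- (l * h)) ^ k) / 2"
      using cosh_le_endpoints[OF \<open>l \<ge> 0\<close>, of ?p t ?q x] t by simp
    then have "C * (cosh (l * (t - x)) - 1) \<le> ?B - e"
      using \<open>C \<ge> 0\<close> by (simp add: mult_left_mono)
    moreover have "\<bar>f t - v\<bar> \<le> e + C * (cosh (l * (t - x)) - 1)"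
      using bd[of t] order_trans[OF pq(1), of t] t by simp
    ultimately show "norm (f t - v) \<le> ?B"
      by simp
  qed (use pq in auto)
  moreover have "integral {?p..?q} (\<lambda>t. f t - v) = integral {?p..?q} f - h * v"
    using pq by (subst integral_diff) (auto intro!: integrable_continuous_interval cont)
  ultimately have "\<bar>integral {?p..?q} f - h * v\<bar> \<le> ?B * h"
    using pq by simp
  moreover have "\<bar>integral {?p..?q} f - h * v\<bar> = \<bar>integral {?p..?q} f / h - v\<bar> * h"
    using \<open>h > 0\<close> by (simp add: abs_mult field_simps flip: abs_mult_pos)
  ultimately show ?thesis
    using \<open>h > 0\<close> by simp
qed

text \<open>On cell \<open>k\<close> the growth bound on \<open>f\<close> yields a constant times
  \<open>exp (l * h) ^ k\<close>, so the generating function with coefficients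
  \<open>\<bar>c i\<bar>\<close> at \<open>exp (l * h)\<close> gives a convergent majorant.\<close>

lemma summable_appell_cell_integrals:
  fixes f :: "real \<Rightarrow> real"
  assumes f: "continuous_on {0..} f" and "h > 0" and "l \<ge> 0" and "y \<ge> 0"
    and bd: "\<And>t. t \<ge> 0 \<Longrightarrow> \<bar>f t\<bar> \<le> B * exp (l * t)" and "B \<ge> 0"
    and sm: "summable (\<lambda>i. \<bar>c i\<bar> * exp (l * h) ^ i)"
  shows "summable (\<lambda>k. appell c k y * integral {real k * h..(real k + 1) * h} f)"
proof (rule summable_comparison_test')
  let ?u = "exp (l * h)"
  have "summable (\<lambda>k. appell (\<lambda>i. \<bar>c i\<bar>) k y * ?u ^ k)"
    using appell_generating_function[of "\<lambda>i. \<bar>c i\<bar>" ?u] sm by (auto simp: sums_iff)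
  from summable_mult[OF this, of "B * ?u * h"]
  show "summable (\<lambda>k. (B * ?u * h) * (appell (\<lambda>i. \<bar>c i\<bar>) k y * ?u ^ k))" .
  fix k :: nat
  let ?p = "real k * h" and ?q = "(real k + 1) * h"
  have pq: "0 \<le> ?p" "?p \<le> ?q" "?q - ?p = h"
    using \<open>h > 0\<close> by (auto simp: algebra_simps)
  have "norm (integral {?p..?q} f) \<le> (B * exp (l * ?q)) * (?q - ?p)"
  proof (rule integral_bound)
    show "continuous_on {?p..?q} f"
      by (rule continuous_on_subset[OF f]) (use pq in auto)
    fix t assume t: "t \<in> {?p..?q}"
    then have "B * exp (l * t) \<le> B * exp (l * ?q)"
      using \<open>l \<ge> 0\<close> \<open>B \<ge> 0\<close> by (intro mult_left_mono) (auto intro: mult_left_mono)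
    with bd[of t] order_trans[OF pq(1), of t] t show "norm (f t) \<le> B * exp (l * ?q)"
      by simp
  qed (use pq in auto)
  moreover have "exp (l * ?q) = ?u * ?u ^ k"
    by (simp flip: exp_add exp_of_nat_mult add: algebra_simps)
  ultimately have "\<bar>integral {?p..?q} f\<bar> \<le> B * ?u * h * ?u ^ k"
    using pq by (simp add: mult_ac)
  then have "\<bar>appell c k y\<bar> * \<bar>integral {?p..?q} f\<bar> \<le> appell (\<lambda>i. \<bar>c i\<bar>) k y * (B * ?u * h * ?u ^ k)"
    using abs_appell_le[OF \<open>y \<ge> 0\<close>, of c k] by (intro mult_mono) auto
  then show "norm (appell c k y * integral {?p..?q} f) \<le> (B * ?u * h) * (appell (\<lambda>i. \<bar>c i\<bar>) k y * ?u ^ k)"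
    by (simp add: abs_mult mult_ac)
qed

section \<open>Error bound independent of the point\<close>

text \<open>The normalised weights sum to 1, so the error is a weighted sum of cell means of
  \<open>f - v\<close>, estimated by \<open>cell_mean_bound\<close> and summed by the generating
  function. In the application \<open>v\<close> is \<open>f x\<close>; on the right \<open>x\<close>
  survives only through its upper bound \<open>a\<close>.\<close>

lemma appell_operator_error:
  fixes f :: "real \<Rightarrow> real"
  assumes f: "continuous_on {0..} f" and "h > 0" and "C \<ge> 0" and "l \<ge> 0"
    and x: "0 \<le> x" "x \<le> a"
    and bd: "\<And>t. t \<ge> 0 \<Longrightarrow> \<bar>f t - v\<bar> \<le> e + C * (cosh (l * (t - x)) - 1)"
    and sm: "summable (\<lambda>i. \<bar>c i\<bar>)" "summable (\<lambda>i. \<bar>c i\<bar> * exp (l * h) ^ i)"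
    and smf: "summable (\<lambda>k. appell c k (x / h) * integral {real k * h..(real k + 1) * h} f)"
    and G: "suminf c \<noteq> 0"
  defines "A \<equiv> \<lambda>u. \<Sum>i. \<bar>c i\<bar> * u ^ i"
  shows "\<bar>exp (- (x / h)) / suminf c * (1 / h) *
      (\<Sum>k. appell c k (x / h) * integral {real k * h..(real k + 1) * h} f) - v\<bar> \<le>
    (e * A 1 + C * ((exp (l * h) * A (exp (l * h)) * exp (a * ((exp (l * h) - 1) / h - l)) +
       A (exp (- l * h)) * exp (a * ((exp (- l * h) - 1) / h + l))) / 2 - A 1)) / \<bar>suminf c\<bar>"
proof -
  define y where "y = x / h"
  define I where "I = (\<lambda>k. integral {real k * h..(real k + 1) * h} f)"
  define q where "q = (\<lambda>k. appell (\<lambda>i. \<bar>c i\<bar>) k y)"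
  define u w where "u = exp (l * h)" and "w = exp (- l * h)"
  define B where "B = (\<lambda>k. e + C * ((u * exp (- (l * x)) * u ^ k + exp (l * x) * w ^ k) / 2 - 1))"
  have "y \<ge> 0"
    using x \<open>h > 0\<close> by (simp add: y_def)
  have "u > 0" "w > 0" "w \<le> 1"
    using \<open>h > 0\<close> \<open>l \<ge> 0\<close> by (auto simp: u_def w_def)
  have smw: "summable (\<lambda>i. \<bar>c i\<bar> * w ^ i)"
    by (rule summable_comparison_test'[OF sm(1)])
      (use \<open>w > 0\<close> \<open>w \<le> 1\<close> in \<open>auto simp: abs_mult power_le_one intro!: mult_left_le\<close>)
  have gen: "(\<lambda>k. q k * z ^ k) sums (A z * exp (y * z))"
    if "summable (\<lambda>i. \<bar>c i\<bar> * z ^ i)" "z > 0" for z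
    using appell_generating_function[of "\<lambda>i. \<bar>c i\<bar>" z y] that by (simp add: q_def A_def)
  have q1: "q sums (A 1 * exp y)"
    using gen[of 1] sm by simp
  have qu: "(\<lambda>k. q k * u ^ k) sums (A u * exp (y * u))"
    using gen[of u] sm \<open>u > 0\<close> by (simp add: u_def)
  have qw: "(\<lambda>k. q k * w ^ k) sums (A w * exp (y * w))"
    using gen[of w] smw \<open>w > 0\<close> by simp
  have p1: "(\<lambda>k. appell c k y) sums (suminf c * exp y)"
    using appell_generating_function[of c 1 y] sm by simp
  have bound: "\<bar>I k / h - v\<bar> \<le> B k" for k
    using cell_mean_bound[OF f \<open>h > 0\<close> \<open>C \<ge> 0\<close> \<open>l \<ge> 0\<close> bd] by (simp add: I_def B_def u_def w_def)
  \<comment> \<open>The sum of \<open>q k * B k\<close>: each geometric sequence in \<open>B\<close>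
    is replaced by the matching value of the generating function.\<close>
  define S where "S = e * (A 1 * exp y) + C * ((u * exp (- (l * x)) * (A u * exp (y * u)) +
      exp (l * x) * (A w * exp (y * w))) / 2 - A 1 * exp y)"
  have "(\<lambda>k. e * q k + C * ((u * exp (- (l * x)) * (q k * u ^ k) +
      exp (l * x) * (q k * w ^ k)) / 2 - q k)) sums S"
    unfolding S_def by (intro sums_add sums_mult sums_diff sums_divide q1 qu qw)
  then have SB: "(\<lambda>k. q k * B k) sums S"
    by (rule sums_cong[THEN iffD1, rotated]) (simp add: B_def algebra_simps)
  have le: "norm (appell c k y * (I k / h - v)) \<le> q k * B k" for k
    unfolding q_def real_norm_def abs_mult
    by (rule mult_mono[OF abs_appell_le[OF \<open>y \<ge> 0\<close>] bound])
      (use abs_appell_le[OF \<open>y \<ge> 0\<close>, of c k] in auto)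
  have "(\<lambda>k. appell c k y * I k) sums (\<Sum>k. appell c k y * I k)"
    using smf by (simp add: I_def y_def summable_sums)
  \<comment> \<open>Subtracting \<open>v\<close> times the series \<open>p1\<close> moves
    \<open>v\<close> inside the sum, next to the cell mean.\<close>
  from sums_diff[OF sums_divide[OF this, of h] sums_mult2[OF p1, of v]]
  have T: "(\<lambda>k. appell c k y * (I k / h - v)) sums
      ((\<Sum>k. appell c k y * I k) / h - suminf c * exp y * v)"
    by (simp add: algebra_simps)
  have "\<bar>(\<Sum>k. appell c k y * I k) / h - suminf c * exp y * v\<bar> \<le> S"
    using norm_suminf_le[OF le sums_summable[OF SB]] SB T by (simp add: sums_iff)
  then have "\<bar>exp (- y) / suminf c\<bar> * \<bar>(\<Sum>k. appell c k y * I k) / h - suminf c * exp y * v\<bar> \<le>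
      \<bar>exp (- y) / suminf c\<bar> * S"
    by (rule mult_left_mono) auto
  moreover have "exp (- y) / suminf c * ((\<Sum>k. appell c k y * I k) / h - suminf c * exp y * v) =
      exp (- y) / suminf c * (1 / h) * (\<Sum>k. appell c k y * I k) - v"
    using G by (simp add: right_diff_distrib exp_minus field_simps)
  ultimately have "\<bar>exp (- y) / suminf c * (1 / h) * (\<Sum>k. appell c k y * I k) - v\<bar> \<le>
      \<bar>exp (- y) / suminf c\<bar> * S"
    by (metis abs_mult)
  also have "\<dots> = (exp (- y) * S) / \<bar>suminf c\<bar>"
    by simp
  also have "exp (- y) * S \<le> e * A 1 + C * ((u * A u * exp (a * ((u - 1) / h - l)) +
      A w * exp (a * ((w - 1) / h + l))) / 2 - A 1)"
  proof -
    have "exp (- y) * S = e * A 1 + C * ((u * A u * (exp (- y) * exp (- (l * x)) * exp (y * u)) +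
        A w * (exp (- y) * exp (l * x) * exp (y * w))) / 2 - A 1)"
      by (simp add: S_def exp_minus field_simps)
    also have "exp (- y) * exp (- (l * x)) * exp (y * u) = exp (x * ((u - 1) / h - l))"
      by (simp flip: exp_add add: y_def algebra_simps diff_divide_distrib)
    also have "exp (- y) * exp (l * x) * exp (y * w) = exp (x * ((w - 1) / h + l))"
      by (simp flip: exp_add add: y_def algebra_simps diff_divide_distrib)
    finally have eq: "exp (- y) * S = e * A 1 + C * ((u * A u * exp (x * ((u - 1) / h - l)) +
        A w * exp (x * ((w - 1) / h + l))) / 2 - A 1)" .
    \<comment> \<open>Both follow from \<open>1 + z \<le> exp z\<close>. Nonnegativity of the
      exponents is what allows \<open>x\<close> to be replaced by \<open>a\<close>.\<close>
    have nn: "0 \<le> (u - 1) / h - l" "0 \<le> (w - 1) / h + l"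
      using exp_ge_add_one_self[of "l * h"] exp_ge_add_one_self[of "- l * h"] \<open>h > 0\<close>
      by (auto simp: u_def w_def field_simps)
    have "A u \<ge> 0" "A w \<ge> 0"
      using sm smw \<open>u > 0\<close> \<open>w > 0\<close> by (auto simp: A_def u_def intro!: suminf_nonneg)
    then show ?thesis
      unfolding eq using x nn \<open>C \<ge> 0\<close> \<open>u > 0\<close>
      by (intro add_mono mult_left_mono diff_mono divide_right_mono order_refl)
        (auto intro!: mult_right_mono)
  qed
  finally show ?thesis
    by (simp add: y_def I_def u_def w_def divide_right_mono)
qed

section \<open>Modulus of continuity in terms of \<open>cosh\<close>\<close>

text \<open>Close to \<open>x\<close>, uniform continuity gives \<open>e\<close>. Away from
  \<open>x\<close>, \<open>cosh (l * (t - x)) - 1\<close> is bounded below by a positive constant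
  and grows like \<open>exp (l * \<bar>t - x\<bar>)\<close>, so a multiple of it absorbs the growth
  of \<open>f\<close>. One \<open>C\<close> serves all \<open>x\<close> up to
  \<open>a\<close>.\<close>

lemma C_E_cosh_modulus:
  fixes f :: "real \<Rightarrow> real"
  assumes f: "continuous_on {0..} f" and "l > 0" and "e > 0"
    and bd: "\<And>t. t \<ge> 0 \<Longrightarrow> \<bar>f t\<bar> \<le> B * exp (l * t)" and "B \<ge> 0"
  obtains C where "C \<ge> 0"
    "\<And>x t. \<lbrakk>0 \<le> x; x \<le> a; 0 \<le> t\<rbrakk> \<Longrightarrow> \<bar>f t - f x\<bar> \<le> e + C * (cosh (l * (t - x)) - 1)"
proof -
  have "uniformly_continuous_on {0..a + 1} f"
    by (intro compact_uniformly_continuous continuous_on_subset[OF f]) auto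
  then obtain d where "d > 0"
    and d: "\<And>x t. \<lbrakk>x \<in> {0..a + 1}; t \<in> {0..a + 1}; \<bar>t - x\<bar> < d\<rbrakk> \<Longrightarrow> \<bar>f t - f x\<bar> < e"
    unfolding uniformly_continuous_on_def dist_real_def using \<open>e > 0\<close> by metis
  \<comment> \<open>The cap 1 keeps \<open>t\<close> inside \<open>{0..a + 1}\<close> whenever
    \<open>\<bar>t - x\<bar> < s\<close>.\<close>
  define s where "s = min d 1"
  define K where "K = cosh (l * s) - 1"
  have "s > 0"
    using \<open>d > 0\<close> by (simp add: s_def)
  then have "K > 0"
    using cosh_real_strict_mono[of 0 "l * s"] \<open>l > 0\<close> by (simp add: K_def)
  \<comment> \<open>As \<open>t\<close> and \<open>x\<close> are at most
    \<open>a + \<bar>t - x\<bar>\<close>,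
    \<open>2 * B * exp (l * a) * exp (l * \<bar>t - x\<bar>)\<close> bounds
    \<open>\<bar>f t\<bar> + \<bar>f x\<bar>\<close>. The factor \<open>2 + 2 / K\<close> comes from
    \<open>2 * D + 2\<close> with \<open>D \<ge> K\<close>.\<close>
  define C where "C = 2 * B * exp (l * a) * (2 + 2 / K)"
  show ?thesis
  proof (rule that)
    show "C \<ge> 0"
      using \<open>B \<ge> 0\<close> \<open>K > 0\<close> by (simp add: C_def)
    fix x t :: real assume x: "0 \<le> x" "x \<le> a" and t: "0 \<le> t"
    define D where "D = cosh (l * (t - x)) - 1"
    have "D \<ge> 0"
      using cosh_real_ge_1 by (simp add: D_def)
    show "\<bar>f t - f x\<bar> \<le> e + C * (cosh (l * (t - x)) - 1)"
    proof (cases "\<bar>t - x\<bar> < s")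
      case True
      then have "\<bar>f t - f x\<bar> < e"
        by (intro d) (use x t in \<open>auto simp: s_def\<close>)
      then show ?thesis
        using \<open>C \<ge> 0\<close> \<open>D \<ge> 0\<close> by (simp add: D_def add_increasing2)
    next
      case False
      have "cosh (l * s) \<le> cosh (l * \<bar>t - x\<bar>)"
        using False \<open>s > 0\<close> \<open>l > 0\<close> by (intro cosh_real_nonneg_le_iff[THEN iffD2]) auto
      moreover have cabs: "cosh (l * \<bar>t - x\<bar>) = cosh (l * (t - x))"
        by (cases "t \<ge> x") (auto simp: abs_if cosh_minus[of "l * (t - x)", symmetric] algebra_simps)
      ultimately have "K \<le> D"
        by (simp add: K_def D_def)
      have "exp (l * \<bar>t - x\<bar>) \<le> 2 * cosh (l * \<bar>t - x\<bar>)"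
        by (simp add: cosh_field_def)
      also have "\<dots> = 2 * D + 2"
        by (simp add: cabs D_def)
      also have "\<dots> \<le> (2 + 2 / K) * D"
        using \<open>K \<le> D\<close> \<open>K > 0\<close> by (simp add: field_simps)
      finally have E: "exp (l * \<bar>t - x\<bar>) \<le> (2 + 2 / K) * D" .
      have "exp (l * t) \<le> exp (l * a) * exp (l * \<bar>t - x\<bar>)"
        "exp (l * x) \<le> exp (l * a) * exp (l * \<bar>t - x\<bar>)"
        using x \<open>l > 0\<close> by (auto simp flip: exp_add distrib_left)
      then have "B * exp (l * t) + B * exp (l * x) \<le> 2 * B * exp (l * a) * exp (l * \<bar>t - x\<bar>)"
        using \<open>B \<ge> 0\<close> by (simp flip: distrib_left add: mult.assoc mult.left_commute[of 2] mult_left_mono)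
      also have "\<dots> \<le> C * D"
        unfolding C_def using E \<open>B \<ge> 0\<close> by (simp add: mult.assoc mult_left_mono)
      finally have "\<bar>f t - f x\<bar> \<le> C * D"
        using bd[of t] bd[of x] x t by simp
      then show ?thesis
        using \<open>e > 0\<close> by (simp add: D_def)
    qed
  qed
qed

text \<open>The derivative of \<open>exp (l * x)\<close> at 0, composed with \<open>h\<close>; the
  punctured filter requires \<open>h n\<close> to be eventually nonzero.\<close>

lemma tendsto_exp_difference_quotient:
  fixes l :: real
  assumes "h \<longlonglongrightarrow> 0" and "\<forall>\<^sub>F n in sequentially. h n \<noteq> 0"
  shows "(\<lambda>n. (exp (l * h n) - 1) / h n) \<longlonglongrightarrow> l"
proof -
  have "((\<lambda>x. exp (l * x)) has_field_derivative l) (at 0)"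
    by (auto intro!: derivative_eq_intros)
  then have "((\<lambda>x. (exp (l * x) - 1) / x) \<longlongrightarrow> l) (at 0)"
    by (simp add: DERIV_def)
  moreover have "filterlim h (at 0) sequentially"
    using assms by (auto simp: filterlim_at)
  ultimately show ?thesis
    by (rule filterlim_compose)
qed

section \<open>Passage to the limit\<close>

text \<open>The first conjunct ensures that, for large \<open>n\<close>, the \<open>suminf\<close>
  in the operator is a genuine sum.\<close>

theorem theorem1:
  fixes g :: "complex \<Rightarrow> complex" and c :: "nat \<Rightarrow> real" and r :: real
    and b :: "nat \<Rightarrow> real" and f :: "real \<Rightarrow> real"
  assumes "r > 1"
    and "g analytic_on ball 0 r"
    and "\<And>u. norm u < r \<Longrightarrow> (\<lambda>n. of_real (c n) * u ^ n) sums g u"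
    and "g 1 \<noteq> 0"
    and "\<And>n. n \<ge> 1 \<Longrightarrow> b n > 0"
    and "mono_on {1..} b"
    and "filterlim b at_top sequentially"
    and "(\<lambda>n. b n / real n) \<longlonglongrightarrow> 0"
    and "f \<in> C_E"
  shows "(\<forall>\<^sub>F n in sequentially. \<forall>x\<ge>0. summable (kantorovich_term c b n f x)) \<and>
         (\<forall>a>0. uniform_limit {0..a} (\<lambda>n x. kantorovich_JL g c b n f x) f sequentially)"
proof -
  define h where "h = (\<lambda>n. b n / real n)"
  define G where "G = suminf c"
  define A where "A = (\<lambda>u. \<Sum>i. \<bar>c i\<bar> * u ^ i)"
  obtain l B where "l > 0" "B > 0" and f: "continuous_on {0..} f"
    and fB: "\<And>t. t \<ge> 0 \<Longrightarrow> \<bar>f t\<bar> \<le> B * exp (l * t)"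
    using \<open>f \<in> C_E\<close> unfolding C_E_def by auto
  have smc: "summable (\<lambda>i. c i * s ^ i)" if "0 \<le> s" "s < r" for s
  proof -
    have "(\<lambda>i. of_real (c i * s ^ i) :: complex) sums g (of_real s)"
      using assms(3)[of "of_real s"] that by simp
    from sums_Re[OF this] show ?thesis
      by (auto simp: sums_iff)
  qed
  \<comment> \<open>Convergence at a slightly larger \<open>s'\<close> gives absolute convergence at
    \<open>s\<close>.\<close>
  have sm: "summable (\<lambda>i. \<bar>c i\<bar> * s ^ i)" if "0 \<le> s" "s < r" for s
  proof -
    obtain s' where "s < s'" "s' < r"
      using dense[OF \<open>s < r\<close>] by auto
    then have "summable (\<lambda>i. norm (c i * s ^ i))"
      using smc[of s'] that by (intro powser_insidea[of c s']) auto
    then show ?thesis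
      using that by (simp add: abs_mult)
  qed
  have G: "g 1 = of_real G"
  proof -
    have "c sums G"
      unfolding G_def using smc[of 1] \<open>r > 1\<close> by (intro summable_sums) auto
    then have "(\<lambda>i. of_real (c i) :: complex) sums of_real G"
      by (simp only: sums_of_real_iff)
    then show ?thesis
      using assms(3)[of 1] \<open>r > 1\<close> sums_unique2 by fastforce
  qed
  then have "G \<noteq> 0"
    using \<open>g 1 \<noteq> 0\<close> by auto
  have h0: "h \<longlonglongrightarrow> 0"
    using assms(8) by (simp add: h_def)
  have hpos: "\<forall>\<^sub>F n in sequentially. h n > 0"
    using eventually_ge_at_top[of 1] by eventually_elim (use assms(5) in \<open>auto simp: h_def\<close>)
  have exp1: "(\<lambda>n. exp (m * h n)) \<longlonglongrightarrow> 1" for m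
    using tendsto_exp[OF tendsto_mult_left[OF h0, of m]] by simp
  \<comment> \<open>This is the meaning of \<open>n\<close> large enough. The growth exponent
    \<open>l\<close> of \<open>f\<close> is also the parameter of the \<open>cosh\<close> test
    function.\<close>
  have small: "\<forall>\<^sub>F n in sequentially. exp (l * h n) < r"
    using order_tendstoD(2)[OF exp1 \<open>r > 1\<close>] .
  have term_eq: "kantorovich_term c b n f x =
      (\<lambda>k. appell c k (x / h n) * integral {real k * h n..(real k + 1) * h n} f)" for n x
    by (auto simp: kantorovich_term_def h_def field_simps)
  have JL_eq: "kantorovich_JL g c b n f x = exp (- (x / h n)) / G * (1 / h n) *
      (\<Sum>k. appell c k (x / h n) * integral {real k * h n..(real k + 1) * h n} f)" for n x
    unfolding kantorovich_JL_def term_eq by (simp add: h_def G mult.commute)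
  have smK: "summable (\<lambda>k. appell c k (x / h n) * integral {real k * h n..(real k + 1) * h n} f)"
    if "h n > 0" "exp (l * h n) < r" "x \<ge> 0" for n x
    by (rule summable_appell_cell_integrals[OF f _ _ _ fB])
      (use that \<open>l > 0\<close> \<open>B > 0\<close> sm in auto)
  have "\<forall>\<^sub>F n in sequentially. \<forall>x\<ge>0. summable (kantorovich_term c b n f x)"
    using hpos small unfolding term_eq by eventually_elim (use smK in auto)
  moreover have "uniform_limit {0..a} (\<lambda>n x. kantorovich_JL g c b n f x) f sequentially"
    if "a > 0" for a
  proof (rule uniform_limitI)
    fix \<epsilon> :: real assume "\<epsilon> > 0"
    have "A 1 \<ge> 0"
      using sm[of 1] \<open>r > 1\<close> by (auto simp: A_def intro!: suminf_nonneg)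
    \<comment> \<open>Chosen so that the limiting error \<open>e * A 1 / \<bar>G\<bar>\<close> stays
      below \<open>\<epsilon>\<close>; the \<open>+ 1\<close> keeps the denominator
      positive.\<close>
    define e where "e = \<epsilon> * \<bar>G\<bar> / (2 * (A 1 + 1))"
    have "e > 0"
      using \<open>\<epsilon> > 0\<close> \<open>G \<noteq> 0\<close> \<open>A 1 \<ge> 0\<close> by (simp add: e_def)
    obtain C where "C \<ge> 0" and C: "\<And>x t. \<lbrakk>0 \<le> x; x \<le> a; 0 \<le> t\<rbrakk> \<Longrightarrow>
        \<bar>f t - f x\<bar> \<le> e + C * (cosh (l * (t - x)) - 1)"
      using C_E_cosh_modulus[OF f \<open>l > 0\<close> \<open>e > 0\<close> fB] \<open>B > 0\<close> by (metis less_imp_le)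
    define U where "U = (\<lambda>n. (e * A 1 + C * ((exp (l * h n) * A (exp (l * h n)) *
         exp (a * ((exp (l * h n) - 1) / h n - l)) +
       A (exp (- l * h n)) * exp (a * ((exp (- l * h n) - 1) / h n + l))) / 2 - A 1)) / \<bar>G\<bar>)"
    \<comment> \<open>Here \<open>r > 1\<close> matters: 1 is interior to the disk of convergence,
      and \<open>exp (l * h n)\<close> approaches it from above.\<close>
    have contA: "isCont A 1"
    proof -
      obtain s where "1 < s" "s < r"
        using dense[OF \<open>r > 1\<close>] by auto
      then show ?thesis
        unfolding A_def using sm[of s] by (intro isCont_powser[of _ s]) auto
    qed
    have limA: "(\<lambda>n. A (exp (m * h n))) \<longlonglongrightarrow> A 1" for m
      by (rule isCont_tendsto_compose[OF contA exp1])
    have dq: "(\<lambda>n. (exp (m * h n) - 1) / h n) \<longlonglongrightarrow> m" for m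
      by (rule tendsto_exp_difference_quotient[OF h0]) (use hpos in eventually_elim, auto)
    \<comment> \<open>With \<open>C\<close> fixed, both exponents tend to 0 and the \<open>C\<close>
      term tends to \<open>(A 1 + A 1) / 2 - A 1 = 0\<close>.\<close>
    have "U \<longlonglongrightarrow> (e * A 1 + C * ((1 * A 1 * exp (a * (l - l)) + A 1 * exp (a * (- l + l))) / 2 - A 1)) / \<bar>G\<bar>"
      unfolding U_def by (intro tendsto_intros limA exp1 dq) (use \<open>G \<noteq> 0\<close> in auto)
    then have "U \<longlonglongrightarrow> e * A 1 / \<bar>G\<bar>"
      by simp
    moreover have "e * A 1 / \<bar>G\<bar> < \<epsilon>"
    proof -
      have "e * A 1 / \<bar>G\<bar> = \<epsilon> * (A 1 / (2 * (A 1 + 1)))"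
        using \<open>G \<noteq> 0\<close> by (simp add: e_def)
      also have "\<dots> < \<epsilon> * 1"
        using \<open>\<epsilon> > 0\<close> \<open>A 1 \<ge> 0\<close> by (intro mult_strict_left_mono) (auto simp: field_simps)
      finally show ?thesis by simp
    qed
    ultimately have "\<forall>\<^sub>F n in sequentially. U n < \<epsilon>"
      by (rule order_tendstoD)
    with hpos small
    show "\<forall>\<^sub>F n in sequentially. \<forall>x\<in>{0..a}. dist (kantorovich_JL g c b n f x) (f x) < \<epsilon>"
    proof eventually_elim
      case (elim n)
      show ?case
      proof
        fix x assume x: "x \<in> {0..a}"
        have "\<bar>kantorovich_JL g c b n f x - f x\<bar> \<le> U n"
          unfolding JL_eq U_def G_def A_def
          by (rule appell_operator_error[OF f \<open>h n > 0\<close> \<open>C \<ge> 0\<close>])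
            (use x elim \<open>l > 0\<close> C smK sm[of 1] sm[of "exp (l * h n)"] \<open>r > 1\<close> \<open>G \<noteq> 0\<close> in
              \<open>auto simp: G_def\<close>)
        then show "dist (kantorovich_JL g c b n f x) (f x) < \<epsilon>"
          using elim by (simp add: dist_real_def)
      qed
    qed
  qed
  ultimately show ?thesis
    by blast
qed

end
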